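(* Let $n\ge 1$ be an integer, let $a_1,\dots,a_n$ be positive numbers, let $n\overline{a}=a_1+\dots+a_n$, and let $0<q\le 1$. Then both $$-\frac{d}{dx}\log\frac{\Gamma_q(x+a_1)\Gamma_q(x+a_2)\cdots\Gamma_q(x+a_n)}{\Gamma_q(x+\overline{a})^n}$$ and $$\frac{d}{dx}\log\frac{\Gamma_q(x+a_1)\Gamma_q(x+a_2)\cdots\Gamma_q(x+a_n)}{\Gamma_q(x)^{n-1}\,\Gamma_q(x+a_1+a_2+\dots+a_n)}$$ are completely monotonic functions of $x$ on $(0,\infty)$.
   Context: For $0<q<1$ the $q$-gamma function is $\Gamma_q(x)=(1-q)^{1-x}\prod_{n=0}^\infty \frac{1-q^{n+1}}{1-q^{n+x}}$; for $q=1$, $\Gamma_1=\Gamma$ is the ordinary gamma function. A function $f$ is completely monotonic on an interval $I$ if it has derivatives of all orders on $I$ and $(-1)^m f^{(m)}(x)\ge 0$ for all $x\in I$ and all $m=0,1,2,\dots$. *)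

theory Defs
  imports "HOL-Analysis.Analysis"
begin

text \<open>Only the range \<open>0 < q \<le> 1\<close> and arguments \<open>x > 0\<close> are meaningful. There every factor of the
  infinite product is positive and the product converges.\<close>

definition q_Gamma :: "real \<Rightarrow> real \<Rightarrow> real" where
  "q_Gamma q x =
     (if q = 1 then Gamma x
      else (1 - q) powr (1 - x) * (\<Prod>n. (1 - q ^ (n + 1)) / (1 - q powr (real n + x))))"

text \<open>The witness \<open>F m\<close> is the \<open>m\<close>-th derivative of \<open>f\<close> on \<open>I\<close>: its values there are uniquely
  determined when \<open>I\<close> has more than one point. Derivatives are taken within \<open>I\<close>, hence one-sided at
  endpoints belonging to \<open>I\<close> and two-sided at interior points.\<close>

definition completely_monotonic_on :: "(real \<Rightarrow> real) \<Rightarrow> real set \<Rightarrow> bool" where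
  "completely_monotonic_on f I \<longleftrightarrow>
     is_interval I \<and>
     (\<exists>F :: nat \<Rightarrow> real \<Rightarrow> real.
        (\<forall>x\<in>I. F 0 x = f x) \<and>
        (\<forall>m. \<forall>x\<in>I. (F m has_real_derivative F (Suc m) x) (at x within I)) \<and>
        (\<forall>m. \<forall>x\<in>I. (-1) ^ m * F m x \<ge> 0))"

end

theory Submission
  imports Defs
begin

text \<open>For \<open>0 < q < 1\<close>, expanding \<open>ln (1 - q\<^sup>n q\<^sup>x)\<close> in powers of \<open>q\<^sup>x\<close> gives
  \<open>ln \<Gamma>\<^sub>q(x) = (1 - x) ln (1 - q) + h(q\<^sup>x) - h(q)\<close> with
  \<open>h(y) = \<Sum>k\<ge>1. y^k / (k (1 - q^k))\<close>. Differentiating in \<open>x\<close> multiplies the \<open>k\<close>-th coefficient by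
  \<open>k ln q < 0\<close>, so the derivatives of \<open>ln \<Gamma>\<^sub>q\<close> from the second on alternate in sign; for \<open>q = 1\<close>
  this is the known sign pattern of the polygamma functions. Hence \<open>(-1)\<^sup>m\<close> times the
  \<open>(m+1)\<close>-st derivative of \<open>ln \<Gamma>\<^sub>q\<close> is concave for every \<open>m\<close>. Both claims, differentiated \<open>m\<close> times,
  are Jensen's inequality for these functions: the first at the mean of the points \<open>x + a\<^sub>i\<close>, the
  second on writing \<open>x + a\<^sub>i\<close> as a convex combination of \<open>x\<close> and \<open>x + \<Sum>a\<^sub>j\<close>.\<close>

section \<open>Power series and the Euler operator\<close>

lemma powr_lt_one:
  fixes q x :: real
  assumes "0 < q" "q < 1" "x > 0"
  shows "q powr x < 1"
  using powr_less_mono2[of x q 1] assms by simp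

text \<open>Under \<open>y = q powr t\<close>, d/dt becomes \<open>ln q\<close> times y d/dy. The
  operator y d/dy only multiplies the k-th coefficient by k, so iterating it keeps the series in one
  shape. Termwise differentiation lowers the degree by one, and the factor \<open>x\<close> restores
  it.\<close>

lemma euler_operator_powser:
  fixes c :: "nat \<Rightarrow> real"
  assumes c: "\<And>x. norm x < 1 \<Longrightarrow> summable (\<lambda>k. c k * x ^ k)" and x: "norm x < 1"
  shows "summable (\<lambda>k. real k * c k * x ^ k)"
    and "\<exists>D. ((\<lambda>y. \<Sum>k. c k * y ^ k) has_real_derivative D) (at x) \<and>
             x * D = (\<Sum>k. real k * c k * x ^ k)"
proof -
  have "summable (\<lambda>k. diffs c k * x ^ k)"
    using termdiff_converges[OF x c] by blast
  then have "(\<lambda>k. x * (real k * c k * x ^ (k - Suc 0))) sums (x * (\<Sum>k. diffs c k * x ^ k))"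
    by (intro sums_mult diffs_equiv)
  moreover have "(\<lambda>k. x * (real k * c k * x ^ (k - Suc 0))) = (\<lambda>k. real k * c k * x ^ k)"
  proof
    fix k show "x * (real k * c k * x ^ (k - Suc 0)) = real k * c k * x ^ k"
      by (cases k) auto
  qed
  ultimately have s: "(\<lambda>k. real k * c k * x ^ k) sums (x * (\<Sum>k. diffs c k * x ^ k))"
    by simp
  show "summable (\<lambda>k. real k * c k * x ^ k)"
    using s by (rule sums_summable)
  show "\<exists>D. ((\<lambda>y. \<Sum>k. c k * y ^ k) has_real_derivative D) (at x) \<and>
             x * D = (\<Sum>k. real k * c k * x ^ k)"
    using termdiffs_strong'[OF c x] sums_unique[OF s] by auto
qed

text \<open>This is h after m applications of y d/dy. The term at k = 0 vanishes because
  \<open>1 / 0 = 0\<close>, so the sum effectively starts at k = 1.\<close>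

definition q_log_series :: "real \<Rightarrow> nat \<Rightarrow> real \<Rightarrow> real" where
  "q_log_series q m y = (\<Sum>k. real k ^ m * (1 / (real k * (1 - q ^ k))) * y ^ k)"

text \<open>For m = 0 a geometric series dominates, since k (1 - q^k) \<ge> 1 - q for k \<ge> 1.
  Each further factor k comes from the Euler operator, which preserves convergence on the open unit
  disc.\<close>

lemma q_log_series_summable:
  assumes q: "0 < q" "q < 1" and "norm y < 1"
  shows "summable (\<lambda>k. real k ^ m * (1 / (real k * (1 - q ^ k))) * y ^ k)"
  using \<open>norm y < 1\<close>
proof (induction m arbitrary: y)
  case 0
  have b: "norm (1 / (real k * (1 - q ^ k)) * y ^ k) \<le> 1 / (1 - q) * norm y ^ k" for k
  proof (cases k)
    case 0
    then show ?thesis using q by simp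
  next
    case (Suc j)
    have "q ^ Suc j \<le> q ^ 1"
      using q by (intro power_decreasing) auto
    then have "1 - q \<le> 1 - q ^ k" using Suc by simp
    then have "1 * (1 - q) \<le> real k * (1 - q ^ k)"
      using Suc q by (intro mult_mono) auto
    then have le: "1 - q \<le> real k * (1 - q ^ k)" by simp
    with q have pos: "real k * (1 - q ^ k) > 0" by linarith
    have "1 / (real k * (1 - q ^ k)) \<le> 1 / (1 - q)"
      using le q by (intro divide_left_mono mult_pos_pos pos) auto
    with pos have "norm (1 / (real k * (1 - q ^ k))) \<le> 1 / (1 - q)"
      unfolding real_norm_def by (subst abs_of_nonneg) (auto simp del: zero_less_mult_iff)
    then show ?thesis
      unfolding norm_mult norm_power by (intro mult_right_mono) auto
  qed
  have "summable (\<lambda>k. 1 / (1 - q) * norm y ^ k)"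
    using 0 by (intro summable_mult summable_geometric) simp
  then show ?case
    by (rule summable_comparison_test') (use b in simp)
next
  case (Suc m)
  then show ?case
    using euler_operator_powser(1)[of "\<lambda>k. real k ^ m * (1 / (real k * (1 - q ^ k)))" y]
    by (simp add: mult.assoc)
qed

lemma q_log_series_deriv:
  assumes q: "0 < q" "q < 1" and y: "norm y < 1"
  shows "\<exists>D. (q_log_series q m has_real_derivative D) (at y) \<and> y * D = q_log_series q (Suc m) y"
  using euler_operator_powser(2)[of "\<lambda>k. real k ^ m * (1 / (real k * (1 - q ^ k)))" y]
    q_log_series_summable[OF q] y
  unfolding q_log_series_def by (simp add: mult.assoc)

lemma q_log_series_powr_deriv:
  assumes q: "0 < q" "q < 1" and x: "x > 0"
  shows "((\<lambda>x. q_log_series q m (q powr x)) has_real_derivative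
           ln q * q_log_series q (Suc m) (q powr x)) (at x)"
proof -
  have "norm (q powr x) < 1"
    using q x by (simp add: powr_lt_one)
  then obtain D where D: "(q_log_series q m has_real_derivative D) (at (q powr x))"
    "q powr x * D = q_log_series q (Suc m) (q powr x)"
    using q_log_series_deriv[OF q] by blast
  have "((\<lambda>x. q powr x) has_real_derivative q powr x * ln q) (at x)"
    using q by (auto intro!: derivative_eq_intros)
  from DERIV_chain2[OF D(1) this] D(2)[symmetric] show ?thesis
    by (simp add: mult_ac)
qed

lemma q_log_series_nonneg:
  assumes q: "0 < q" "q < 1" and y: "0 \<le> y" "y < 1"
  shows "q_log_series q m y \<ge> 0"
proof -
  have "q ^ k \<le> 1" for k
    using q by (intro power_le_one) auto
  then show ?thesis
    unfolding q_log_series_def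
    using q y by (intro suminf_nonneg q_log_series_summable mult_nonneg_nonneg) auto
qed

section \<open>Functional equation of h and the infinite product\<close>

lemma q_log_series_diff:
  assumes q: "0 < q" "q < 1" and y: "norm y < 1"
  shows "q_log_series q 0 y - q_log_series q 0 (q * y) = - ln (1 - y)"
proof -
  have qy: "norm (q * y) < 1"
    using q y mult_strict_mono[of q 1 "\<bar>y\<bar>" 1] by (simp add: abs_mult)
  \<comment> \<open>Replacing y by q y multiplies the k-th term by q^k. The difference thus gains
    the factor 1 - q^k, which cancels the denominator and leaves the series of - ln (1 - y).\<close>
  have coeff: "1 / (real k * (1 - q ^ k)) * y ^ k - 1 / (real k * (1 - q ^ k)) * (q * y) ^ k
      = y ^ k / real k" for k
  proof (cases k)
    case (Suc j)
    then have "q ^ k < 1"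
      using q power_Suc_less_one[of q j] by simp
    moreover have "1 / (real k * (1 - q ^ k)) * y ^ k - 1 / (real k * (1 - q ^ k)) * (q * y) ^ k
        = (1 - q ^ k) * y ^ k / (real k * (1 - q ^ k))"
      by (simp add: power_mult_distrib diff_divide_distrib algebra_simps)
    ultimately show ?thesis by simp
  qed simp
  have "(\<lambda>k. 1 / (real k * (1 - q ^ k)) * y ^ k - 1 / (real k * (1 - q ^ k)) * (q * y) ^ k)
      sums (q_log_series q 0 y - q_log_series q 0 (q * y))"
    using q_log_series_summable[OF q y, of 0] q_log_series_summable[OF q qy, of 0]
    unfolding q_log_series_def by (intro sums_diff) (simp_all add: summable_sums)
  then have "(\<lambda>k. y ^ k / real k) sums (q_log_series q 0 y - q_log_series q 0 (q * y))"
    unfolding coeff .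
  moreover have "(\<lambda>k. y ^ k / real k) sums (- ln (1 - y))"
    using sums_minus[OF ln_series'[of "- y"]] y by simp
  ultimately show ?thesis by (rule sums_unique2)
qed

text \<open>By the functional equation at q^i y, each factor is the exponential of a difference of
  consecutive values of h, so the product telescopes.\<close>

lemma q_log_series_telescope:
  assumes q: "0 < q" "q < 1" and y: "0 < y" "y < 1"
  shows "(\<Prod>i<n. 1 / (1 - q ^ i * y)) = exp (q_log_series q 0 y - q_log_series q 0 (q ^ n * y))"
proof (induction n)
  case (Suc n)
  have "q ^ n * y < 1 * 1"
    using q y by (intro mult_le_less_imp_less power_le_one) auto
  then have "norm (q ^ n * y) < 1" "q ^ n * y < 1"
    using q y by (auto simp: abs_mult)
  then have "1 / (1 - q ^ n * y) = exp (q_log_series q 0 (q ^ n * y) - q_log_series q 0 (q ^ Suc n * y))"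
    using q_log_series_diff[OF q, of "q ^ n * y"] by (simp add: exp_minus inverse_eq_divide mult.assoc)
  then show ?case
    using Suc by (simp add: exp_add[symmetric] del: exp_add)
qed simp

text \<open>h is continuous at 0 and has zero constant term, so the remainder left by telescoping
  disappears in the limit.\<close>

lemma q_log_series_tendsto_0:
  assumes q: "0 < q" "q < 1"
  shows "(\<lambda>n. q_log_series q 0 (q ^ n * y)) \<longlonglongrightarrow> 0"
proof -
  have "isCont (q_log_series q 0) 0"
    using q_log_series_deriv[OF q, of 0 0] DERIV_isCont by auto
  moreover have "(\<lambda>n. q ^ n * y) \<longlonglongrightarrow> 0"
    using q by (intro tendsto_mult_left_zero LIMSEQ_realpow_zero) auto
  ultimately have "(\<lambda>n. q_log_series q 0 (q ^ n * y)) \<longlonglongrightarrow> q_log_series q 0 0"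
    by (rule isCont_tendsto_compose)
  moreover have "q_log_series q 0 0 = 0"
    using sums_unique[OF powser_sums_zero[of "\<lambda>k. real k ^ 0 * (1 / (real k * (1 - q ^ k)))"]]
    unfolding q_log_series_def by simp
  ultimately show ?thesis by simp
qed

lemma q_Gamma_eq_exp:
  assumes q: "0 < q" "q < 1" and x: "x > 0"
  shows "q_Gamma q x
    = exp ((1 - x) * ln (1 - q) + (q_log_series q 0 (q powr x) - q_log_series q 0 q))"
proof -
  let ?h = "q_log_series q 0"
  let ?f = "\<lambda>n. (1 - q ^ (n + 1)) / (1 - q powr (real n + x))"
  have y: "0 < q powr x" "q powr x < 1"
    using q x by (auto simp: powr_lt_one)
  have "(\<Prod>i<n. ?f i)
      = exp ((?h (q powr x) - ?h (q ^ n * q powr x)) - (?h q - ?h (q ^ n * q)))" for n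
  proof -
    \<comment> \<open>Numerators and denominators telescope separately, starting from y = q and from
      y = q^x.\<close>
    have "(\<Prod>i<n. ?f i) = (\<Prod>i<n. 1 / (1 - q ^ i * q powr x)) / (\<Prod>i<n. 1 / (1 - q ^ i * q))"
      unfolding prod_dividef[symmetric] using q
      by (intro prod.cong refl) (simp add: powr_add powr_realpow mult_ac)
    then show ?thesis
      using q_log_series_telescope[OF q y] q_log_series_telescope[OF q q] by (simp add: exp_diff)
  qed
  moreover have "(\<lambda>n. exp ((?h (q powr x) - ?h (q ^ n * q powr x)) - (?h q - ?h (q ^ n * q))))
      \<longlonglongrightarrow> exp ((?h (q powr x) - 0) - (?h q - 0))"
    by (intro tendsto_intros q_log_series_tendsto_0 q)
  ultimately have "(\<lambda>n. \<Prod>i<n. ?f i) \<longlonglongrightarrow> exp (?h (q powr x) - ?h q)"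
    by simp
  \<comment> \<open>\<open>raw_has_prod\<close> takes partial products over i \<le> n, hence the
    shift by one; it also demands a nonzero limit, which \<open>exp\<close> provides.\<close>
  then have "(\<lambda>n. \<Prod>i<Suc n. ?f i) \<longlonglongrightarrow> exp (?h (q powr x) - ?h q)"
    by (rule LIMSEQ_Suc)
  then have "?f has_prod exp (?h (q powr x) - ?h q)"
    by (simp add: has_prod_def raw_has_prod_def lessThan_Suc_atMost)
  then have "prodinf ?f = exp (?h (q powr x) - ?h q)"
    by (rule has_prod_unique[symmetric])
  then show ?thesis
    using q by (simp add: q_Gamma_def powr_def exp_add)
qed

lemma q_Gamma_pos:
  assumes "0 < q" "q \<le> 1" "x > 0"
  shows "q_Gamma q x > 0"
  using assms q_Gamma_eq_exp[of q x] by (cases "q = 1") (auto simp: q_Gamma_def)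

section \<open>Derivatives of the logarithm of the q-gamma function and their signs\<close>

lemma ln_q_Gamma_derivs:
  assumes q: "0 < q" "q \<le> 1"
  obtains P :: "nat \<Rightarrow> real \<Rightarrow> real" where
    "\<And>x. x > 0 \<Longrightarrow> ((\<lambda>x. ln (q_Gamma q x)) has_real_derivative P 0 x) (at x)"
    "\<And>m x. x > 0 \<Longrightarrow> (P m has_real_derivative P (Suc m) x) (at x)"
    "\<And>m x. x > 0 \<Longrightarrow> (-1) ^ m * P (Suc (Suc m)) x \<le> 0"
proof (cases "q = 1")
  case True
  show thesis
  proof
    fix x :: real assume x: "x > 0"
    then have nn: "x \<notin> \<int>\<^sub>\<le>\<^sub>0" by (auto elim: nonpos_Ints_cases)
    have "(\<lambda>x. q_Gamma q x) = Gamma"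
      using True by (simp add: q_Gamma_def)
    then show "((\<lambda>x. ln (q_Gamma q x)) has_real_derivative Polygamma 0 x) (at x)"
      using nn Gamma_real_pos[OF x] by (auto intro!: derivative_eq_intros simp del: Gamma_real_pos)
    show "(Polygamma m has_real_derivative Polygamma (Suc m) x) (at x)" for m
      using nn by (rule has_field_derivative_Polygamma)
    \<comment> \<open>The order m + 2 is positive and has the parity of m: polygamma values are
      negative at even and positive at odd orders.\<close>
    show "(-1) ^ m * Polygamma (Suc (Suc m)) x \<le> 0" for m
      using Polygamma_real_odd_pos[OF nn, of "Suc (Suc m)"]
        Polygamma_real_even_neg[OF x, of "Suc (Suc m)"]
      by (cases "even m") auto
  qed
next
  case False
  with q have q: "0 < q" "q < 1" by auto
  \<comment> \<open>\<open>P m\<close> is the derivative of order m + 1, so the chain rule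
    contributes m + 1 factors \<open>ln q\<close>. The linear term (1 - x) ln (1 - q) survives only
    in the first derivative.\<close>
  define P where "P m x = ln q ^ Suc m * q_log_series q (Suc m) (q powr x)
    - (if m = 0 then ln (1 - q) else 0)" for m x
  show thesis
  proof
    fix x :: real assume x: "x > 0"
    note [derivative_intros] = q_log_series_powr_deriv[OF q x]
    have "((\<lambda>x. (1 - x) * ln (1 - q) + (q_log_series q 0 (q powr x) - q_log_series q 0 q))
        has_real_derivative P 0 x) (at x)"
      by (auto intro!: derivative_eq_intros simp: P_def)
    then show "((\<lambda>x. ln (q_Gamma q x)) has_real_derivative P 0 x) (at x)"
      by (rule has_field_derivative_transform_within_open[of _ _ _ "{0<..}"])
        (use x q_Gamma_eq_exp[OF q] in auto)
    show "(P m has_real_derivative P (Suc m) x) (at x)" for m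
      unfolding P_def by (auto intro!: derivative_eq_intros)
    \<comment> \<open>Since ln q < 0, the last factor is the only negative one.\<close>
    have eq: "(-1) ^ m * ln q ^ Suc (Suc (Suc m)) = (- ln q) ^ m * (ln q) ^ 2 * ln q" for m
      by (simp add: power_minus[of "ln q"] power2_eq_square)
    have "(-1) ^ m * ln q ^ Suc (Suc (Suc m)) \<le> 0" for m
      unfolding eq using q zero_le_power[of "- ln q" m]
      by (intro mult_nonneg_nonpos mult_nonneg_nonneg zero_le_power2) auto
    moreover have "q_log_series q m (q powr x) \<ge> 0" for m
      using q x by (intro q_log_series_nonneg) (auto simp: powr_lt_one)
    ultimately have "(-1) ^ m * ln q ^ Suc (Suc (Suc m))
        * q_log_series q (Suc (Suc (Suc m))) (q powr x) \<le> 0" for m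
      by (rule mult_nonpos_nonneg)
    then show "(-1) ^ m * P (Suc (Suc m)) x \<le> 0" for m
      by (simp add: P_def mult.assoc)
  qed
qed

section \<open>Two inequalities of Jensen type for convex functions\<close>

lemma jensen_mean:
  fixes g :: "real \<Rightarrow> real"
  assumes g: "convex_on {0<..} g" and "n \<ge> 1" and x: "x > 0"
    and a: "\<And>i. i \<in> {1..n} \<Longrightarrow> a i > 0" and abar: "real n * abar = (\<Sum>i=1..n. a i)"
  shows "real n * g (x + abar) \<le> (\<Sum>i=1..n. g (x + a i))"
proof -
  have "g (\<Sum>i=1..n. (1 / real n) *\<^sub>R (x + a i)) \<le> (\<Sum>i=1..n. (1 / real n) * g (x + a i))"
    using \<open>n \<ge> 1\<close> x a by (intro convex_on_sum[OF _ _ g]) (auto intro: add_pos_pos)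
  moreover have "(\<Sum>i=1..n. (1 / real n) *\<^sub>R (x + a i)) = (real n * x + real n * abar) / real n"
    unfolding abar by (simp add: sum_divide_distrib[symmetric] sum.distrib)
  moreover have "\<dots> = x + abar"
    using \<open>n \<ge> 1\<close> by (simp add: add_divide_distrib)
  ultimately have "g (x + abar) \<le> (\<Sum>i=1..n. g (x + a i)) / real n"
    by (simp add: sum_divide_distrib)
  then show ?thesis
    using \<open>n \<ge> 1\<close> by (simp add: pos_le_divide_eq mult.commute)
qed

text \<open>On the segment from x to x + S, where S is the sum of the a_i, each point x + a_i lies
  under the chord with weight a_i / S at the far end. These weights add up to 1, leaving n - 1 for
  the near end.\<close>

lemma convex_sum_le_endpoints:
  fixes g :: "real \<Rightarrow> real"
  assumes g: "convex_on {0<..} g" and n: "n \<ge> 1" and x: "x > 0"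
    and a: "\<And>i. i \<in> {1..n} \<Longrightarrow> a i > 0"
  shows "(\<Sum>i=1..n. g (x + a i)) \<le> real (n - 1) * g x + g (x + (\<Sum>i=1..n. a i))"
proof -
  define S where "S = (\<Sum>i=1..n. a i)"
  have S: "S > 0"
    unfolding S_def using n a by (intro sum_pos) auto
  have le: "a i \<le> S" if "i \<in> {1..n}" for i
    unfolding S_def using that a by (intro member_le_sum) (auto intro: less_imp_le)
  have "(\<Sum>i=1..n. g (x + a i)) \<le> (\<Sum>i=1..n. (1 - a i / S) * g x + (a i / S) * g (x + S))"
  proof (rule sum_mono)
    fix i assume i: "i \<in> {1..n}"
    have "g ((1 - a i / S) *\<^sub>R x + (a i / S) *\<^sub>R (x + S))
        \<le> (1 - a i / S) * g x + (a i / S) * g (x + S)"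
      using S x le[OF i] a[OF i] by (intro convex_onD[OF g]) auto
    moreover have "(1 - a i / S) *\<^sub>R x + (a i / S) *\<^sub>R (x + S) = x + a i"
      using S by (simp add: field_simps)
    ultimately show "g (x + a i) \<le> (1 - a i / S) * g x + (a i / S) * g (x + S)"
      by simp
  qed
  also have "\<dots> = (real n - S / S) * g x + (S / S) * g (x + S)"
    by (simp add: sum.distrib sum_distrib_right[symmetric] sum_subtractf
        sum_divide_distrib[symmetric] S_def)
  finally show ?thesis
    using S n by (simp add: of_nat_diff S_def)
qed

section \<open>Complete monotonicity of the two logarithmic derivatives\<close>

lemma completely_monotonic_onI_deriv:
  assumes f: "\<And>x. x > 0 \<Longrightarrow> (f has_real_derivative F 0 x) (at x)"
    and F: "\<And>m x. x > 0 \<Longrightarrow> (F m has_real_derivative F (Suc m) x) (at x)"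
    and pos: "\<And>m x. x > 0 \<Longrightarrow> (-1) ^ m * F m x \<ge> 0"
  shows "completely_monotonic_on (deriv f) {0<..}"
  unfolding completely_monotonic_on_def
proof (intro conjI exI[of _ F])
  show "is_interval {0::real<..}" by simp
qed (use assms in \<open>auto simp: DERIV_imp_deriv[OF f] intro: has_field_derivative_at_within\<close>)

theorem theorem4p1:
  fixes n :: nat and a :: "nat \<Rightarrow> real" and abar q :: real
  assumes "n \<ge> 1"
    and "\<And>i. i \<in> {1..n} \<Longrightarrow> a i > 0"
    and "real n * abar = (\<Sum>i=1..n. a i)"
    and "0 < q" and "q \<le> 1"
  shows "completely_monotonic_on
           (\<lambda>x. - deriv (\<lambda>y. ln ((\<Prod>i=1..n. q_Gamma q (y + a i)) / q_Gamma q (y + abar) ^ n)) x)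
           {0<..}
       \<and> completely_monotonic_on
           (deriv (\<lambda>x. ln ((\<Prod>i=1..n. q_Gamma q (x + a i)) /
                           (q_Gamma q x ^ (n - 1) * q_Gamma q (x + (\<Sum>i=1..n. a i))))))
           {0<..}"
proof -
  obtain P :: "nat \<Rightarrow> real \<Rightarrow> real" where
    P0: "\<And>x. x > 0 \<Longrightarrow> ((\<lambda>x. ln (q_Gamma q x)) has_real_derivative P 0 x) (at x)" and
    P: "\<And>m x. x > 0 \<Longrightarrow> (P m has_real_derivative P (Suc m) x) (at x)" and
    sgn: "\<And>m x. x > 0 \<Longrightarrow> (-1) ^ m * P (Suc (Suc m)) x \<le> 0"
    using ln_q_Gamma_derivs[OF assms(4,5)] by blast
  define S where "S = (\<Sum>i=1..n. a i)"
  have S: "S > 0"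
    unfolding S_def using assms(1,2) by (intro sum_pos) auto
  have "real n * abar > 0"
    using S assms(3) by (simp add: S_def)
  then have abar: "abar > 0"
    by (simp add: zero_less_mult_iff)
  \<comment> \<open>\<open>P (Suc (Suc m))\<close> is the second derivative of \<open>P m\<close>,
    so \<open>sgn\<close> says that (-1)^m \<open>P m\<close> is concave; the minus sign turns this
    into convexity.\<close>
  have conv: "convex_on {0<..} (\<lambda>x. - ((-1) ^ m * P m x))" for m
  proof (rule f''_ge0_imp_convex)
    fix x :: real assume "x \<in> {0<..}"
    then have x: "x > 0" by simp
    show "((\<lambda>x. - ((-1) ^ m * P m x)) has_real_derivative - ((-1) ^ m * P (Suc m) x)) (at x)"
      and "((\<lambda>x. - ((-1) ^ m * P (Suc m) x)) has_real_derivative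
        - ((-1) ^ m * P (Suc (Suc m)) x)) (at x)"
      by (intro DERIV_minus DERIV_cmult P x)+
    show "- ((-1) ^ m * P (Suc (Suc m)) x) \<ge> 0"
      using sgn[OF x] by simp
  qed simp
  note pos = q_Gamma_pos[OF assms(4,5)]
  have shift0: "((\<lambda>x. ln (q_Gamma q (x + b))) has_real_derivative P 0 (x + b)) (at x)"
    if "x > 0" "b \<ge> 0" for x b
    using P0[of "x + b"] that by (simp add: DERIV_shift)
  have shift: "((\<lambda>x. P m (x + b)) has_real_derivative P (Suc m) (x + b)) (at x)"
    if "x > 0" "b \<ge> 0" for m x b
    using P[of "x + b" m] that by (simp add: DERIV_shift)
  have a: "0 \<le> a i" if "i \<in> {1..n}" for i
    using assms(2)[OF that] by simp

  have nz: "q_Gamma q (y + a i) \<noteq> 0" if "y > 0" "i \<in> {1..n}" for y i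
    using a[OF that(2)] that pos[of "y + a i"] by simp
  have prod_nz: "(\<Prod>i=1..n. q_Gamma q (y + a i)) \<noteq> 0" if "y > 0" for y
    using nz[OF that] by simp
  have ln_prod: "ln (\<Prod>i=1..n. q_Gamma q (y + a i)) = (\<Sum>i=1..n. ln (q_Gamma q (y + a i)))"
    if "y > 0" for y
    using nz[OF that] by (intro ln_prod) auto

  let ?f = "\<lambda>y. ln ((\<Prod>i=1..n. q_Gamma q (y + a i)) / q_Gamma q (y + abar) ^ n)"
  define F where "F m x = (\<Sum>i=1..n. P m (x + a i)) - real n * P m (x + abar)" for m x
  have ln_f: "?f y = (\<Sum>i=1..n. ln (q_Gamma q (y + a i))) - real n * ln (q_Gamma q (y + abar))"
    if "y > 0" for y
  proof -
    have "q_Gamma q (y + abar) > 0"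
      using that abar by (intro pos) auto
    then show ?thesis
      using ln_prod[OF that] prod_nz[OF that]
      by (simp add: ln_div ln_realpow del: prod_zero_iff)
  qed
  have dF: "(?f has_real_derivative F 0 x) (at x)" if x: "x > 0" for x
  \<comment> \<open>The logarithm has been split only for positive arguments, so the derivative is
    transferred along the open half-line.\<close>
  proof (rule has_field_derivative_transform_within_open)
    show "((\<lambda>y. (\<Sum>i=1..n. ln (q_Gamma q (y + a i))) - real n * ln (q_Gamma q (y + abar)))
        has_real_derivative F 0 x) (at x)"
      unfolding F_def using x a abar
      by (intro DERIV_diff DERIV_sum DERIV_cmult shift0) auto
    show "x \<in> {0<..}" using x by simp
    show "(\<Sum>i=1..n. ln (q_Gamma q (y + a i))) - real n * ln (q_Gamma q (y + abar)) = ?f y"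
      if "y \<in> {0<..}" for y
      using ln_f[of y] that by simp
  qed simp
  have "completely_monotonic_on (deriv (\<lambda>x. - ?f x)) {0<..}"
  proof (rule completely_monotonic_onI_deriv)
    fix x :: real and m assume x: "x > 0"
    show "((\<lambda>x. - ?f x) has_real_derivative - F 0 x) (at x)"
      by (rule DERIV_minus[OF dF[OF x]])
    show "((\<lambda>x. - F m x) has_real_derivative - F (Suc m) x) (at x)"
      unfolding F_def using x a abar
      by (intro DERIV_minus DERIV_diff DERIV_sum DERIV_cmult shift) auto
    show "(-1) ^ m * - F m x \<ge> 0"
      using jensen_mean[OF conv[of m] assms(1) x assms(2,3)]
      by (simp add: F_def sum_negf sum_distrib_left[symmetric] algebra_simps)
  qed
  \<comment> \<open>On the half-line both functions equal - \<open>F 0\<close>, so the minus sign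
    may leave \<open>deriv\<close>.\<close>
  then have "completely_monotonic_on (\<lambda>x. - deriv ?f x) {0<..}"
    unfolding completely_monotonic_on_def
    using DERIV_imp_deriv[OF dF] DERIV_imp_deriv[OF DERIV_minus[OF dF]] by simp

  moreover
  let ?g = "\<lambda>x. ln ((\<Prod>i=1..n. q_Gamma q (x + a i)) / (q_Gamma q x ^ (n - 1) * q_Gamma q (x + S)))"
  define G where "G m x = (\<Sum>i=1..n. P m (x + a i)) - (real (n - 1) * P m x + P m (x + S))" for m x
  have ln_g: "?g y = (\<Sum>i=1..n. ln (q_Gamma q (y + a i)))
      - (real (n - 1) * ln (q_Gamma q y) + ln (q_Gamma q (y + S)))" if "y > 0" for y
  proof -
    have "q_Gamma q (y + S) > 0" "q_Gamma q y > 0"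
      using that S by (auto intro: pos)
    then show ?thesis
      using ln_prod[OF that] prod_nz[OF that]
      by (simp add: ln_div ln_mult ln_realpow del: prod_zero_iff)
  qed
  have "completely_monotonic_on (deriv ?g) {0<..}"
  proof (rule completely_monotonic_onI_deriv)
    fix x :: real and m assume x: "x > 0"
    show "(?g has_real_derivative G 0 x) (at x)"
    proof (rule has_field_derivative_transform_within_open)
      show "((\<lambda>y. (\<Sum>i=1..n. ln (q_Gamma q (y + a i)))
          - (real (n - 1) * ln (q_Gamma q y) + ln (q_Gamma q (y + S)))) has_real_derivative G 0 x) (at x)"
        unfolding G_def using x a S
        by (intro DERIV_diff DERIV_add DERIV_sum DERIV_cmult shift0 P0) auto
      show "x \<in> {0<..}" using x by simp
      show "(\<Sum>i=1..n. ln (q_Gamma q (y + a i)))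
          - (real (n - 1) * ln (q_Gamma q y) + ln (q_Gamma q (y + S))) = ?g y"
        if "y \<in> {0<..}" for y
        using ln_g[of y] that by simp
    qed simp
    show "(G m has_real_derivative G (Suc m) x) (at x)"
      unfolding G_def using x a S
      by (intro DERIV_diff DERIV_add DERIV_sum DERIV_cmult shift P) auto
    \<comment> \<open>The sum over x + a_i is now on the smaller side of the convexity inequality,
      the reverse of the mean case; hence \<open>G\<close> carries no minus sign while
      \<open>F\<close> did.\<close>
    show "(-1) ^ m * G m x \<ge> 0"
      using convex_sum_le_endpoints[OF conv[of m] assms(1) x assms(2)]
      by (simp add: G_def S_def sum_negf sum_distrib_left[symmetric] algebra_simps)
  qed
  ultimately show ?thesis
    unfolding S_def by blast
qed

end
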